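(* Let $g\in\mathcal G$, $\alpha\in(0,1)$, $w\in(0,1]$, $\lambda>0$, and define $$H_1(x)=x+\big(R_2(x)\wedge R_3(x)\big)\vee R_1(x),\qquad H_2(x)=-\lambda\wedge\big(x+R_1(x)\big).$$ Then, for all $x$ with $|x|>t_\alpha$, $$\operatorname{U}_\alpha(x)=H_1(x)\mathbf 1\big(H_1(x)\ge\lambda\big)+H_2(x)\mathbf 1\big(H_1(x)<\lambda\big).$$
   Context: $a\wedge b$ and $a\vee b$ denote minimum and maximum; $H_1(x)=x+\big[(R_2(x)\wedge R_3(x))\vee R_1(x)\big]$ and $H_2(x)=\min(-\lambda,x+R_1(x))$. $\mathcal G$ is the class of positive continuous probability densities $g$ on $\mathbb R$ that are symmetric around zero and strictly decreasing on $[0,\infty)$. $G$ is the c.d.f. of $g$ and $G^{-1}$ its inverse on $(0,1)$, extended by $G^{-1}(p)=+\infty$ for $p\ge1$ and $G^{-1}(p)=-\infty$ for $p\le0$. Put $\Delta_\lambda(x)=G(\lambda-x)-G(-\lambda-x)$. $t_\alpha=t_\alpha(g,\lambda,w)$ is the (unique, if it exists) non-negative solution $t$ of $\frac{w}{1-w}\frac{G(t-\lambda)+G(-t-\lambda)}{g(t)}=\frac{\alpha}{1-\alpha}$; if no such solution exists (in particular if $w=1$), $t_\alpha=-\infty$. Define $$R_1(x)=G^{-1}\Big(1-\tfrac\alpha2-\tfrac{1-w}{2w}\alpha g(x)-\tfrac{1-\alpha}2\Delta_\lambda(x)\Big),$$ $$R_2(x)=G^{-1}\Big(1-\alpha-\tfrac{1-w}{w}\alpha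 g(x)+\alpha\Delta_\lambda(x)+G(-\lambda-x)\Big),$$ $$R_3(x)=G^{-1}\Big(1-\tfrac\alpha2-\tfrac{1-w}{2w}\alpha g(x)+\tfrac\alpha2\Delta_\lambda(x)\Big).$$ With $\mathcal T_\alpha=\{x:|x|>t_\alpha\}$, the regimes (which partition $\mathcal T_\alpha$) are $\mathcal X_{\mathrm I}=\{x\in\mathcal T_\alpha:|x|>\lambda+R_1(x)\}$, $\mathcal X_{\mathrm{II}}=\{x\in\mathcal T_\alpha:-\lambda+R_3(x)<x\le\lambda+R_1(x)\}$, $\mathcal X_{\mathrm{III}}=\{x\in\mathcal T_\alpha:|x|\le-\lambda+R_3(x)\}$, $\mathcal X_{\mathrm{IV}}=\{x\in\mathcal T_\alpha:-x\in\mathcal X_{\mathrm{II}}\}$. For $x\in\mathcal T_\alpha$, $\operatorname{U}_\alpha(x)$ (the upper end of the HPD credible set) equals $x+R_1(x)$ on $\mathcal X_{\mathrm I}$, $x+R_2(x)$ on $\mathcal X_{\mathrm{II}}$, $x+R_3(x)$ on $\mathcal X_{\mathrm{III}}$ and $-\lambda$ on $\mathcal X_{\mathrm{IV}}$. *)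

theory Defs
  imports "HOL-Probability.Probability"
begin

definition density_class :: "(real \<Rightarrow> real) set" where
  "density_class = {g. continuous_on UNIV g \<and> (\<forall>x. 0 < g x) \<and>
     prob_space (density lborel (\<lambda>x. ennreal (g x))) \<and>
     (\<forall>x. g (- x) = g x) \<and> (\<forall>x y. 0 \<le> x \<longrightarrow> x < y \<longrightarrow> g y < g x)}"

definition dens_cdf :: "(real \<Rightarrow> real) \<Rightarrow> real \<Rightarrow> real" where
  "dens_cdf g = cdf (density lborel (\<lambda>x. ennreal (g x)))"

text \<open>The c.d.f. of a positive density is a bijection from the reals onto \<open>{0<..<1}\<close>, so \<open>inv\<close> is only
  ever evaluated at points with a unique preimage.\<close>

definition quantile :: "(real \<Rightarrow> real) \<Rightarrow> real \<Rightarrow> ereal" where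
  "quantile g p = (if 1 \<le> p then \<infinity> else if p \<le> 0 then - \<infinity> else ereal (inv (dens_cdf g) p))"

definition Delta :: "(real \<Rightarrow> real) \<Rightarrow> real \<Rightarrow> real \<Rightarrow> real" where
  "Delta g lam x = dens_cdf g (lam - x) - dens_cdf g (- lam - x)"

definition is_threshold :: "(real \<Rightarrow> real) \<Rightarrow> real \<Rightarrow> real \<Rightarrow> real \<Rightarrow> real \<Rightarrow> bool" where
  "is_threshold g \<alpha> w lam t \<longleftrightarrow> w \<noteq> 1 \<and> 0 \<le> t \<and>
     w / (1 - w) * ((dens_cdf g (t - lam) + dens_cdf g (- t - lam)) / g t) = \<alpha> / (1 - \<alpha>)"

definition threshold :: "(real \<Rightarrow> real) \<Rightarrow> real \<Rightarrow> real \<Rightarrow> real \<Rightarrow> ereal" where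
  "threshold g \<alpha> w lam =
     (if \<exists>!t. is_threshold g \<alpha> w lam t then ereal (THE t. is_threshold g \<alpha> w lam t) else - \<infinity>)"

definition R1 :: "(real \<Rightarrow> real) \<Rightarrow> real \<Rightarrow> real \<Rightarrow> real \<Rightarrow> real \<Rightarrow> ereal" where
  "R1 g \<alpha> w lam x = quantile g
     (1 - \<alpha> / 2 - (1 - w) / (2 * w) * \<alpha> * g x - (1 - \<alpha>) / 2 * Delta g lam x)"

definition R2 :: "(real \<Rightarrow> real) \<Rightarrow> real \<Rightarrow> real \<Rightarrow> real \<Rightarrow> real \<Rightarrow> ereal" where
  "R2 g \<alpha> w lam x = quantile g
     (1 - \<alpha> - (1 - w) / w * \<alpha> * g x + \<alpha> * Delta g lam x + dens_cdf g (- lam - x))"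

definition R3 :: "(real \<Rightarrow> real) \<Rightarrow> real \<Rightarrow> real \<Rightarrow> real \<Rightarrow> real \<Rightarrow> ereal" where
  "R3 g \<alpha> w lam x = quantile g
     (1 - \<alpha> / 2 - (1 - w) / (2 * w) * \<alpha> * g x + \<alpha> / 2 * Delta g lam x)"

definition T_set :: "(real \<Rightarrow> real) \<Rightarrow> real \<Rightarrow> real \<Rightarrow> real \<Rightarrow> real set" where
  "T_set g \<alpha> w lam = {x. threshold g \<alpha> w lam < ereal \<bar>x\<bar>}"

definition X_I :: "(real \<Rightarrow> real) \<Rightarrow> real \<Rightarrow> real \<Rightarrow> real \<Rightarrow> real set" where
  "X_I g \<alpha> w lam = {x \<in> T_set g \<alpha> w lam. ereal lam + R1 g \<alpha> w lam x < ereal \<bar>x\<bar>}"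

definition X_II :: "(real \<Rightarrow> real) \<Rightarrow> real \<Rightarrow> real \<Rightarrow> real \<Rightarrow> real set" where
  "X_II g \<alpha> w lam = {x \<in> T_set g \<alpha> w lam.
     ereal (- lam) + R3 g \<alpha> w lam x < ereal x \<and> ereal x \<le> ereal lam + R1 g \<alpha> w lam x}"

definition X_III :: "(real \<Rightarrow> real) \<Rightarrow> real \<Rightarrow> real \<Rightarrow> real \<Rightarrow> real set" where
  "X_III g \<alpha> w lam = {x \<in> T_set g \<alpha> w lam. ereal \<bar>x\<bar> \<le> ereal (- lam) + R3 g \<alpha> w lam x}"

definition X_IV :: "(real \<Rightarrow> real) \<Rightarrow> real \<Rightarrow> real \<Rightarrow> real \<Rightarrow> real set" where
  "X_IV g \<alpha> w lam = {x \<in> T_set g \<alpha> w lam. - x \<in> X_II g \<alpha> w lam}"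

text \<open>The four regimes partition \<open>T_set\<close> (for parameters in the intended range), so the order of the
  case distinction is irrelevant and the final branch is reached only outside \<open>T_set\<close>.
  Values are extended reals because the quantile may be infinite.\<close>

definition U_end :: "(real \<Rightarrow> real) \<Rightarrow> real \<Rightarrow> real \<Rightarrow> real \<Rightarrow> real \<Rightarrow> ereal" where
  "U_end g \<alpha> w lam x =
     (if x \<in> X_I g \<alpha> w lam then ereal x + R1 g \<alpha> w lam x
      else if x \<in> X_II g \<alpha> w lam then ereal x + R2 g \<alpha> w lam x
      else if x \<in> X_III g \<alpha> w lam then ereal x + R3 g \<alpha> w lam x
      else if x \<in> X_IV g \<alpha> w lam then ereal (- lam)
      else undefined)"

definition H1 :: "(real \<Rightarrow> real) \<Rightarrow> real \<Rightarrow> real \<Rightarrow> real \<Rightarrow> real \<Rightarrow> ereal" where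
  "H1 g \<alpha> w lam x =
     ereal x + max (min (R2 g \<alpha> w lam x) (R3 g \<alpha> w lam x)) (R1 g \<alpha> w lam x)"

definition H2 :: "(real \<Rightarrow> real) \<Rightarrow> real \<Rightarrow> real \<Rightarrow> real \<Rightarrow> real \<Rightarrow> ereal" where
  "H2 g \<alpha> w lam x = min (ereal (- lam)) (ereal x + R1 g \<alpha> w lam x)"

end

theory Submission
  imports Defs
begin

text \<open>
  Everything reduces to comparing the arguments of the quantile function. Write
  \<open>p\<^sub>1, p\<^sub>2, p\<^sub>3\<close> for the arguments in \<open>R1\<close>, \<open>R2\<close>, \<open>R3\<close>, \<open>D\<close> for \<open>Delta g lam x\<close> and \<open>G\<close> for
  \<open>dens_cdf g\<close>. They satisfy \<open>p\<^sub>3 = p\<^sub>1 + D / 2\<close> and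
  \<open>p\<^sub>2 = 2 * p\<^sub>3 - 1 + G (- lam - x) = 2 * p\<^sub>1 - 1 + G (lam - x)\<close>.
  For \<open>w < 1\<close> the left-hand side of the threshold equation is strictly increasing and unbounded in \<open>t \<ge> 0\<close>
  (\<open>outer_mass_ratio_strict_mono\<close>, \<open>outer_mass_ratio_unbounded\<close>), so beyond the threshold it exceeds
  \<open>\<alpha> / (1 - \<alpha>)\<close>. This inequality is equivalent to \<open>p\<^sub>1 > 1/2\<close> (\<open>beyond_threshold_density_bound\<close>),
  which for \<open>w = 1\<close> is just \<open>D < 1\<close>.
  Since \<open>0 < D < 1\<close>, it follows that \<open>1/2 < p\<^sub>1 < p\<^sub>3 < 1\<close>, so that \<open>R1 < R3\<close> are both finite.

  With \<open>G (- y) = 1 - G y\<close> the two expressions for \<open>p\<^sub>2\<close> turn the order among the radii into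
  inequalities for \<open>x\<close> (\<open>radii\<close>):
  \<open>R1 \<le> R2\<close> iff \<open>x \<le> lam + R1\<close>, and \<open>R3 \<le> R2\<close> iff \<open>x \<le> -lam + R3\<close>, while \<open>lam \<le> x + R2\<close> always.
  These are the inequalities that separate the regimes: \<open>max (min R2 R3) R1\<close> selects \<open>R1\<close> on the
  positive part of regime I, \<open>R2\<close> on regime II and \<open>R3\<close> on regime III. Moreover \<open>lam \<le> H1\<close> is
  equivalent to \<open>lam \<le> x + R3\<close>; this fails precisely on regime IV and on the negative part of
  regime I, and there the minimum in \<open>H2\<close> decides between the two.
\<close>

section \<open>Distribution functions of symmetric unimodal densities\<close>

context
  fixes g :: "real \<Rightarrow> real"
  assumes g: "g \<in> density_class"
begin

lemma density_continuous: "continuous_on A g"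
  and density_pos: "0 < g x"
  and density_even: "g (- x) = g x"
  using g continuous_on_subset[of UNIV g A] by (auto simp: density_class_def)

lemma density_strict_antimono: "0 \<le> x \<Longrightarrow> x < y \<Longrightarrow> g y < g x"
  using g by (auto simp: density_class_def)

lemma density_measurable [measurable]: "g \<in> borel_measurable borel"
  using density_continuous by (rule borel_measurable_continuous_onI)

lemma density_antimono_abs: "\<bar>x\<bar> \<le> \<bar>y\<bar> \<Longrightarrow> g y \<le> g x"
  using density_strict_antimono[of "\<bar>x\<bar>" "\<bar>y\<bar>"] density_even[of x] density_even[of y]
  by (cases "\<bar>x\<bar> = \<bar>y\<bar>") (auto simp: abs_if split: if_splits)

lemma real_distribution_density: "real_distribution (density lborel (\<lambda>x. ennreal (g x)))"
  using g by (simp add: density_class_def real_distribution_def real_distribution_axioms_def)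

lemma dens_cdf_diff:
  assumes "a \<le> b"
  shows "dens_cdf g b - dens_cdf g a = integral {a..b} g"
proof -
  let ?M = "density lborel (\<lambda>x. ennreal (g x))"
  interpret real_distribution ?M by (rule real_distribution_density)
  have int: "(g has_integral integral {a..b} g) {a..b}"
    by (intro integrable_integral integrable_continuous_real density_continuous)
  have "(g has_integral integral {a..b} g) {a<..b}"
    by (rule has_integral_spike_set_eq[THEN iffD1, OF _ _ int]) (auto intro: negligible_subset[of "{a}"])
  then have "emeasure ?M {a<..b} = ennreal (integral {a..b} g)"
    using nn_integral_has_integral_lebesgue'[of "{a<..b}" g] density_pos
    by (simp add: emeasure_density less_imp_le)
  moreover have "emeasure ?M {a<..b} = ennreal (dens_cdf g b - dens_cdf g a)"
    using emeasure_Ioc[OF assms] by (simp add: dens_cdf_def)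
  moreover have "0 \<le> dens_cdf g b - dens_cdf g a"
    using cdf_nondecreasing[OF assms] by (simp add: dens_cdf_def)
  moreover have "0 \<le> integral {a..b} g"
    using has_integral_nonneg[OF int] density_pos by (simp add: less_imp_le)
  ultimately show ?thesis by simp
qed

lemma DERIV_dens_cdf: "(dens_cdf g has_real_derivative g x) (at x)"
proof -
  let ?F = "\<lambda>y. dens_cdf g (x - 1) + integral {x - 1..y} g"
  have "((\<lambda>y. integral {x - 1..y} g) has_real_derivative g x) (at x within {x - 1..x + 1})"
    by (intro integral_has_real_derivative density_continuous) auto
  then have "((\<lambda>y. integral {x - 1..y} g) has_real_derivative g x) (at x)"
    by (subst (asm) at_within_interior) (auto simp: interior_atLeastAtMost_real)
  then have "(?F has_real_derivative g x) (at x)"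
    by (auto intro!: derivative_eq_intros)
  then show ?thesis
  proof (rule DERIV_cong_ev[THEN iffD1, OF refl _ refl, rotated])
    have "\<forall>\<^sub>F y in nhds x. y \<in> {x - 1<..}"
      by (intro eventually_nhds_in_open) auto
    then show "\<forall>\<^sub>F y in nhds x. ?F y = dens_cdf g y"
      by eventually_elim (simp add: dens_cdf_diff[symmetric])
  qed
qed

lemma dens_cdf_strict_mono: "strict_mono (dens_cdf g)"
  by (rule strict_monoI) (metis DERIV_pos_imp_increasing DERIV_dens_cdf density_pos)

lemma dens_cdf_le_iff [simp]: "dens_cdf g x \<le> dens_cdf g y \<longleftrightarrow> x \<le> y"
  by (rule strict_mono_less_eq[OF dens_cdf_strict_mono])

lemma dens_cdf_less_iff [simp]: "dens_cdf g x < dens_cdf g y \<longleftrightarrow> x < y"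
  by (rule strict_mono_less[OF dens_cdf_strict_mono])

lemma dens_cdf_at_top: "(dens_cdf g \<longlongrightarrow> 1) at_top"
  and dens_cdf_at_bot: "(dens_cdf g \<longlongrightarrow> 0) at_bot"
proof -
  interpret real_distribution "density lborel (\<lambda>x. ennreal (g x))"
    by (rule real_distribution_density)
  show "(dens_cdf g \<longlongrightarrow> 1) at_top" "(dens_cdf g \<longlongrightarrow> 0) at_bot"
    unfolding dens_cdf_def by (fact cdf_lim_at_top_prob, fact cdf_lim_at_bot)
qed

text \<open>The derivative of \<open>G y + G (- y)\<close> vanishes by the symmetry of \<open>g\<close>; the constant is identified
  by letting \<open>y\<close> tend to infinity.\<close>

lemma dens_cdf_uminus: "dens_cdf g (- x) = 1 - dens_cdf g x"
proof -
  let ?S = "\<lambda>y. dens_cdf g y + dens_cdf g (- y)"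
  have "(?S has_real_derivative 0) (at y)" for y
    by (rule derivative_eq_intros DERIV_chain'[OF _ DERIV_dens_cdf] DERIV_dens_cdf refl)+
       (simp add: density_even)
  then have const: "?S y = ?S x" for y
    by (intro DERIV_isconst_all) auto
  have "(?S \<longlongrightarrow> 1 + 0) at_top"
    by (intro tendsto_add dens_cdf_at_top
        filterlim_compose[OF dens_cdf_at_bot filterlim_uminus_at_bot_at_top])
  then have "((\<lambda>_::real. ?S x) \<longlongrightarrow> 1 + 0) at_top"
    by (rule Lim_transform_eventually) (intro always_eventually allI const)
  then have "?S x = 1"
    by (simp add: tendsto_const_iff)
  then show ?thesis by simp
qed

lemma dens_cdf_pos: "0 < dens_cdf g x"
proof -
  interpret real_distribution "density lborel (\<lambda>x. ennreal (g x))"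
    by (rule real_distribution_density)
  have "0 \<le> dens_cdf g (x - 1)" by (simp add: dens_cdf_def cdf_nonneg)
  also have "\<dots> < dens_cdf g x" by simp
  finally show ?thesis .
qed

lemma dens_cdf_less_1: "dens_cdf g x < 1"
  using dens_cdf_pos[of "- x"] by (simp add: dens_cdf_uminus)

lemma dens_cdf_quantile:
  assumes "0 < p" "p < 1"
  obtains r where "quantile g p = ereal r" "dens_cdf g r = p"
proof -
  obtain a where a: "dens_cdf g a < p"
    using order_tendstoD(2)[OF dens_cdf_at_bot \<open>0 < p\<close>] by (auto simp: eventually_at_bot_linorder)
  obtain b where b: "p < dens_cdf g b"
    using order_tendstoD(1)[OF dens_cdf_at_top \<open>p < 1\<close>] by (auto simp: eventually_at_top_linorder)
  from a b have "a \<le> b" by (metis dens_cdf_less_iff less_imp_le less_trans)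
  then obtain x where "dens_cdf g x = p"
    using IVT'[of "dens_cdf g" a p b] a b DERIV_continuous_on[of _ "dens_cdf g" g]
    by (metis DERIV_dens_cdf has_field_derivative_at_within less_imp_le)
  then show thesis
    using assms strict_mono_imp_inj_on[OF dens_cdf_strict_mono]
    by (intro that[of x]) (auto simp: quantile_def inv_f_eq)
qed

text \<open>With the infinite values of the quantile this Galois connection holds for every real \<open>p\<close>. It
  allows comparisons with \<open>R2\<close>, whose argument may exceed 1.\<close>

lemma le_quantile_iff: "ereal r \<le> quantile g p \<longleftrightarrow> dens_cdf g r \<le> p"
proof (cases "0 < p \<and> p < 1")
  case True
  then obtain q where "quantile g p = ereal q" "dens_cdf g q = p"
    using dens_cdf_quantile by blast
  then show ?thesis by auto
next
  case False
  then show ?thesis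
    using dens_cdf_pos[of r] dens_cdf_less_1[of r] by (auto simp: quantile_def)
qed

section \<open>The threshold\<close>

lemma Delta_pos: "0 < lam \<Longrightarrow> 0 < Delta g lam x"
  by (simp add: Delta_def)

lemma outer_mass_eq: "dens_cdf g (x - lam) + dens_cdf g (- x - lam) = 1 - Delta g lam x"
  using dens_cdf_uminus[of "x - lam"] by (simp add: Delta_def minus_diff_commute)

lemma Delta_uminus: "Delta g lam (- x) = Delta g lam x"
  using outer_mass_eq[of x lam] outer_mass_eq[of "- x" lam] unfolding minus_minus by linarith

lemma Delta_less_1: "Delta g lam x < 1"
  using outer_mass_eq[of x lam] dens_cdf_pos[of "x - lam"] dens_cdf_pos[of "- x - lam"] by linarith

text \<open>The window of half-width \<open>lam\<close> loses mass as its centre moves away from the mode.\<close>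

lemma Delta_antimono:
  assumes "0 < lam" "0 \<le> s" "s \<le> t"
  shows "Delta g lam t \<le> Delta g lam s"
proof (rule DERIV_nonpos_imp_nonincreasing[OF \<open>s \<le> t\<close>])
  fix x assume "s \<le> x" "x \<le> t"
  have "(Delta g lam has_real_derivative (g (- lam - x) - g (lam - x))) (at x)"
    unfolding Delta_def[abs_def]
    by (rule derivative_eq_intros DERIV_chain'[OF _ DERIV_dens_cdf] refl)+ simp
  moreover have "g (- lam - x) \<le> g (lam - x)"
    using assms \<open>s \<le> x\<close> by (intro density_antimono_abs) auto
  ultimately show "\<exists>y. (Delta g lam has_real_derivative y) (at x) \<and> y \<le> 0"
    by auto
qed

lemma outer_mass_ratio_strict_mono:
  assumes "0 < lam" "0 \<le> s" "s < t"
  shows "(1 - Delta g lam s) / g s < (1 - Delta g lam t) / g t"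
  using assms Delta_antimono[of lam s t] Delta_less_1[of lam s] density_strict_antimono[of s t]
    density_pos[of t]
  by (intro frac_less2) auto

text \<open>Being decreasing, \<open>g\<close> is bounded at \<open>t \<ge> 1\<close> by the mass of \<open>{t - 1..t}\<close>, which vanishes because the
  total mass is finite.\<close>

lemma density_tendsto_0: "(g \<longlongrightarrow> 0) at_top"
proof (rule tendsto_sandwich[of "\<lambda>_. 0" g at_top "\<lambda>t. dens_cdf g t - dens_cdf g (t + (-1))"])
  have "((\<lambda>t. dens_cdf g (t + (-1))) \<longlongrightarrow> 1) at_top"
    by (rule filterlim_compose[OF dens_cdf_at_top])
       (rule filterlim_tendsto_add_at_top[OF tendsto_const filterlim_ident, simplified add.commute])
  then show "((\<lambda>t. dens_cdf g t - dens_cdf g (t + (-1))) \<longlongrightarrow> 0) at_top"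
    using tendsto_diff[OF dens_cdf_at_top] by fastforce
  show "\<forall>\<^sub>F t in at_top. g t \<le> dens_cdf g t - dens_cdf g (t + (-1))"
    using eventually_ge_at_top[of 1]
  proof (rule eventually_mono)
    fix t :: real assume "1 \<le> t"
    then obtain z where "t - 1 < z" "z < t"
      "dens_cdf g t - dens_cdf g (t - 1) = (t - (t - 1)) * g z"
      using MVT2[of "t - 1" t "dens_cdf g" g] DERIV_dens_cdf by auto
    with \<open>1 \<le> t\<close> show "g t \<le> dens_cdf g t - dens_cdf g (t + (-1))"
      using density_strict_antimono[of z t] by simp
  qed
qed (auto simp: density_pos less_imp_le)

lemma outer_mass_ratio_unbounded:
  assumes "0 < lam"
  obtains t where "s \<le> t" "0 \<le> t" "B < (1 - Delta g lam t) / g t"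
proof -
  let ?B = "\<bar>B\<bar> + 1"
  have "0 < (1 - Delta g lam 0) / ?B" using Delta_less_1[of lam 0] by simp
  then have "\<forall>\<^sub>F t in at_top. g t < (1 - Delta g lam 0) / ?B"
    by (rule order_tendstoD(2)[OF density_tendsto_0])
  with eventually_ge_at_top[of "max s 0"]
  have "\<forall>\<^sub>F t in at_top. max s 0 \<le> t \<and> g t < (1 - Delta g lam 0) / ?B"
    by eventually_elim auto
  then obtain t where t: "max s 0 \<le> t" "g t < (1 - Delta g lam 0) / ?B"
    by (auto simp: eventually_at_top_linorder)
  then have "?B < (1 - Delta g lam 0) / g t"
    using density_pos[of t] by (simp add: field_simps)
  also have "\<dots> \<le> (1 - Delta g lam t) / g t"
    using t Delta_antimono[OF assms, of 0 t] density_pos[of t]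
    by (intro divide_right_mono) (auto simp: less_imp_le)
  finally show thesis using t by (intro that[of t]) auto
qed

lemma continuous_on_outer_mass_ratio: "continuous_on A (\<lambda>t. (1 - Delta g lam t) / g t)"
proof -
  have G: "continuous_on UNIV (dens_cdf g)"
    by (meson DERIV_continuous_on DERIV_dens_cdf has_field_derivative_at_within)
  show ?thesis
    unfolding Delta_def
    by (intro continuous_intros density_continuous continuous_on_compose2[OF G])
       (auto simp: density_pos less_imp_neq[symmetric])
qed

text \<open>Strict monotonicity makes a solution unique. If the ratio were still too small at \<open>\<bar>x\<bar>\<close>, then by
  unboundedness the solution would exist and lie at or above \<open>\<bar>x\<bar>\<close>. Clearing denominators brings the
  inequality into a form that covers \<open>w = 1\<close> as well, where no solution exists.\<close>

lemma beyond_threshold_density_bound: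
  assumes "0 < \<alpha>" "\<alpha> < 1" "0 < w" "w \<le> 1" "0 < lam"
    and x: "threshold g \<alpha> w lam < ereal \<bar>x\<bar>"
  shows "(1 - w) / w * \<alpha> * g x < (1 - \<alpha>) * (1 - Delta g lam x)"
proof (cases "w = 1")
  case True
  then show ?thesis using assms Delta_less_1[of lam x] by simp
next
  case False
  define \<Phi> where "\<Phi> t = (1 - Delta g lam t) / g t" for t
  define K where "K = \<alpha> / (1 - \<alpha>) * ((1 - w) / w)"
  have thr: "is_threshold g \<alpha> w lam t \<longleftrightarrow> 0 \<le> t \<and> \<Phi> t = K" for t
  proof -
    have eq: "w / (1 - w) * y = A \<longleftrightarrow> y = A * ((1 - w) / w)" for y A
      using assms False by (auto simp: field_simps)
    show ?thesis
      by (simp only: is_threshold_def outer_mass_eq \<Phi>_def K_def eq) (simp add: False)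
  qed
  have mono: "\<Phi> s < \<Phi> t" if "0 \<le> s" "s < t" for s t
    using outer_mass_ratio_strict_mono[of lam s t] that assms by (simp add: \<Phi>_def)
  have unique: "s = t" if "is_threshold g \<alpha> w lam s" "is_threshold g \<alpha> w lam t" for s t
    using that mono[of s t] mono[of t s] by (cases s t rule: linorder_cases) (auto simp: thr)
  have "K < \<Phi> \<bar>x\<bar>"
  proof (rule ccontr)
    assume "\<not> K < \<Phi> \<bar>x\<bar>"
    moreover obtain b where "\<bar>x\<bar> \<le> b" "K < \<Phi> b"
      using outer_mass_ratio_unbounded[OF \<open>0 < lam\<close>, of "\<bar>x\<bar>" K] by (auto simp: \<Phi>_def)
    ultimately obtain t where t: "\<bar>x\<bar> \<le> t" "\<Phi> t = K"
      using IVT'[of \<Phi> "\<bar>x\<bar>" K b] continuous_on_outer_mass_ratio[of "{\<bar>x\<bar>..b}" lam]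
      by (auto simp: \<Phi>_def[abs_def])
    then have is_t: "is_threshold g \<alpha> w lam t" by (simp add: thr)
    then have ex1: "\<exists>!t. is_threshold g \<alpha> w lam t" using unique by blast
    then have "threshold g \<alpha> w lam = ereal t"
      using the1_equality[OF ex1 is_t] by (simp add: threshold_def)
    with x t show False by simp
  qed
  moreover have "g \<bar>x\<bar> = g x" "Delta g lam \<bar>x\<bar> = Delta g lam x"
    by (auto simp: abs_if density_even Delta_uminus)
  ultimately have "K * g x < 1 - Delta g lam x"
    using density_pos[of x] by (simp add: \<Phi>_def field_simps)
  then have "(1 - \<alpha>) * (K * g x) < (1 - \<alpha>) * (1 - Delta g lam x)"
    using assms by (intro mult_strict_left_mono) auto
  then show ?thesis
    using assms by (simp add: K_def mult.commute mult.left_commute)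
qed

section \<open>Comparing the three radii\<close>

text \<open>Symmetry of \<open>R1\<close> and \<open>R3\<close> links regime IV to regime II.\<close>

lemma R1_uminus: "R1 g \<alpha> w lam (- x) = R1 g \<alpha> w lam x"
  and R3_uminus: "R3 g \<alpha> w lam (- x) = R3 g \<alpha> w lam x"
  by (simp_all add: R1_def R3_def density_even Delta_uminus)

text \<open>The two equivalences are read off from \<open>p\<^sub>2 = 2 * p\<^sub>1 - 1 + G (lam - x)\<close> and
  \<open>p\<^sub>2 = 2 * p\<^sub>3 - 1 + G (- lam - x)\<close>, and the lower bound on \<open>R2\<close> from the first of these together
  with \<open>p\<^sub>1 > 1/2\<close>. The final implication holds because \<open>p\<^sub>1 < G (- lam - x)\<close> entails
  \<open>p\<^sub>3 = p\<^sub>1 + D / 2 < G (- lam - x) + D = G (lam - x)\<close>.\<close>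

lemma radii:
  assumes "0 < \<alpha>" "\<alpha> < 1" "0 < w" "w \<le> 1" "0 < lam"
    and "threshold g \<alpha> w lam < ereal \<bar>x\<bar>"
  obtains r1 r3 where "R1 g \<alpha> w lam x = ereal r1" "R3 g \<alpha> w lam x = ereal r3" "r1 < r3"
    "ereal r1 \<le> R2 g \<alpha> w lam x \<longleftrightarrow> x \<le> lam + r1"
    "ereal r3 \<le> R2 g \<alpha> w lam x \<longleftrightarrow> x \<le> - lam + r3"
    "ereal (lam - x) \<le> R2 g \<alpha> w lam x"
    "lam + r1 < - x \<Longrightarrow> x + r3 < lam"
proof -
  let ?G = "dens_cdf g"
  define c where "c = (1 - w) / w * \<alpha> * g x"
  define D where "D = Delta g lam x"
  define p1 where "p1 = 1 - \<alpha> / 2 - c / 2 - (1 - \<alpha>) / 2 * D"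
  define p2 where "p2 = 1 - \<alpha> - c + \<alpha> * D + ?G (- lam - x)"
  define p3 where "p3 = 1 - \<alpha> / 2 - c / 2 + \<alpha> / 2 * D"
  have c_half: "(1 - w) / (2 * w) * \<alpha> * g x = c / 2"
    by (simp add: c_def)
  have R: "R1 g \<alpha> w lam x = quantile g p1" "R2 g \<alpha> w lam x = quantile g p2"
    "R3 g \<alpha> w lam x = quantile g p3"
    unfolding R1_def R2_def R3_def p1_def p2_def p3_def c_half D_def by (simp_all add: c_def)
  have c: "0 \<le> c" "c < (1 - \<alpha>) * (1 - D)"
    using assms density_pos[of x] beyond_threshold_density_bound[OF assms] by (auto simp: c_def D_def)
  have D: "0 < D" "D < 1"
    using Delta_pos[OF \<open>0 < lam\<close>] Delta_less_1 by (auto simp: D_def)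
  have D_eq: "D = ?G (lam - x) - ?G (- lam - x)"
    by (simp add: D_def Delta_def)
  have p3_eq: "p3 = p1 + D / 2"
    by (simp add: p1_def p3_def field_simps)
  have p2_eq: "p2 = 2 * p3 - 1 + ?G (- lam - x)" "p2 = 2 * p1 - 1 + ?G (lam - x)"
    using D_eq by (simp_all add: p1_def p2_def p3_def field_simps)
  have p1: "1 / 2 < p1"
    using c(2) by (simp add: p1_def field_simps)
  have "\<alpha> * D < \<alpha>" using D assms by simp
  with c have p3: "p3 < 1" by (simp add: p3_def)
  obtain r1 where r1: "quantile g p1 = ereal r1" "?G r1 = p1"
    using dens_cdf_quantile[of p1] p1 p3 p3_eq D by auto
  obtain r3 where r3: "quantile g p3 = ereal r3" "?G r3 = p3"
    using dens_cdf_quantile[of p3] p1 p3 p3_eq D by auto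
  have refl1: "?G (lam - x) = 1 - ?G (x - lam)" and refl2: "?G (- lam - x) = 1 - ?G (lam + x)"
    using dens_cdf_uminus[of "x - lam"] dens_cdf_uminus[of "lam + x"] by (simp_all add: algebra_simps)
  have "?G r1 < ?G r3"
    using r1 r3 p3_eq D by simp
  then have "r1 < r3" by simp
  moreover have "ereal r1 \<le> R2 g \<alpha> w lam x \<longleftrightarrow> ?G (x - lam) \<le> ?G r1"
    unfolding R le_quantile_iff using r1 p2_eq(2) refl1 by auto
  then have "ereal r1 \<le> R2 g \<alpha> w lam x \<longleftrightarrow> x \<le> lam + r1"
    by auto
  moreover have "ereal r3 \<le> R2 g \<alpha> w lam x \<longleftrightarrow> ?G (lam + x) \<le> ?G r3"
    unfolding R le_quantile_iff using r3 p2_eq(1) refl2 by auto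
  then have "ereal r3 \<le> R2 g \<alpha> w lam x \<longleftrightarrow> x \<le> - lam + r3"
    by auto
  moreover have "ereal (lam - x) \<le> R2 g \<alpha> w lam x"
    unfolding R le_quantile_iff using p1 p2_eq(2) by simp
  moreover have "x + r3 < lam" if "lam + r1 < - x"
  proof -
    have "?G r1 < ?G (- lam - x)" using that by simp
    then have "?G r3 < ?G (lam - x)" using r1(2) r3(2) p3_eq D(1) D_eq by linarith
    then show ?thesis by simp
  qed
  ultimately show thesis
    using that r1(1) r3(1) R by simp
qed

end

section \<open>The upper end of the credible set\<close>

theorem theorem2p6:
  fixes g :: "real \<Rightarrow> real" and \<alpha> w lam :: real
  assumes "g \<in> density_class"
    and "\<alpha> \<in> {0<..<1}"
    and "w \<in> {0<..1}"
    and "0 < lam"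
  shows "\<forall>x::real. threshold g \<alpha> w lam < ereal \<bar>x\<bar> \<longrightarrow>
     U_end g \<alpha> w lam x =
       H1 g \<alpha> w lam x * of_bool (ereal lam \<le> H1 g \<alpha> w lam x) +
       H2 g \<alpha> w lam x * of_bool (H1 g \<alpha> w lam x < ereal lam)"
proof (intro allI impI)
  fix x :: real
  assume x: "threshold g \<alpha> w lam < ereal \<bar>x\<bar>"
  obtain r1 r3 where r1: "R1 g \<alpha> w lam x = ereal r1" and r3: "R3 g \<alpha> w lam x = ereal r3"
    and r13: "r1 < r3"
    and le1: "ereal r1 \<le> R2 g \<alpha> w lam x \<longleftrightarrow> x \<le> lam + r1"
    and le3: "ereal r3 \<le> R2 g \<alpha> w lam x \<longleftrightarrow> x \<le> - lam + r3"
    and ge_lam: "ereal (lam - x) \<le> R2 g \<alpha> w lam x"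
    and far: "lam + r1 < - x \<Longrightarrow> x + r3 < lam"
    using radii[OF assms(1) _ _ _ _ assms(4) x] assms(2,3) by auto
  define m where "m = max (min (R2 g \<alpha> w lam x) (ereal r3)) (ereal r1)"
  have H1: "H1 g \<alpha> w lam x = ereal x + m"
    by (simp add: H1_def m_def r1 r3)
  have H2: "H2 g \<alpha> w lam x = ereal (min (- lam) (x + r1))"
    by (simp add: H2_def r1 ereal_min)
  have T: "x \<in> T_set g \<alpha> w lam" "- x \<in> T_set g \<alpha> w lam"
    using x by (auto simp: T_set_def)
  have I: "x \<in> X_I g \<alpha> w lam \<longleftrightarrow> lam + r1 < \<bar>x\<bar>"
    and II: "x \<in> X_II g \<alpha> w lam \<longleftrightarrow> - lam + r3 < x \<and> x \<le> lam + r1"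
    and III: "x \<in> X_III g \<alpha> w lam \<longleftrightarrow> \<bar>x\<bar> \<le> - lam + r3"
    and IV: "x \<in> X_IV g \<alpha> w lam \<longleftrightarrow> - lam + r3 < - x \<and> - x \<le> lam + r1"
    using T R1_uminus[OF assms(1)] R3_uminus[OF assms(1)]
    by (simp_all add: X_I_def X_II_def X_III_def X_IV_def r1 r3)
  have U: "U_end g \<alpha> w lam x =
      (if lam + r1 < \<bar>x\<bar> then ereal (x + r1)
       else if - lam + r3 < x then ereal x + R2 g \<alpha> w lam x
       else if \<bar>x\<bar> \<le> - lam + r3 then ereal (x + r3) else ereal (- lam))"
    unfolding U_end_def I II III IV r1 r3 by auto
  have "ereal (lam - x) \<le> m \<longleftrightarrow> lam \<le> x + r3"
    using ge_lam r13 by (auto simp: m_def le_max_iff_disj less_imp_le)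
  then have ge: "ereal lam \<le> H1 g \<alpha> w lam x \<longleftrightarrow> lam \<le> x + r3"
    unfolding H1 by (cases m) (auto simp: algebra_simps)
  have "U_end g \<alpha> w lam x =
      (if lam \<le> x + r3 then H1 g \<alpha> w lam x else H2 g \<alpha> w lam x)"
  proof (cases "lam \<le> x + r3")
    case True
    \<comment> \<open>This excludes the negative part of regime I, so only the comparisons with \<open>R2\<close> matter.\<close>
    then have "\<not> lam + r1 < - x" using far by auto
    consider "lam + r1 < x" | "x \<le> lam + r1" "- lam + r3 < x" | "x \<le> lam + r1" "x \<le> - lam + r3"
      by linarith
    then have "U_end g \<alpha> w lam x = ereal x + m"
    proof cases
      case 1
      then have "R2 g \<alpha> w lam x \<le> ereal r1" using le1 by auto
      then have "m = ereal r1" by (simp add: m_def min.coboundedI1 max.absorb2)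
      with 1 show ?thesis by (auto simp: U abs_if)
    next
      case 2
      then have "R2 g \<alpha> w lam x \<le> ereal r3" "ereal r1 \<le> R2 g \<alpha> w lam x"
        using le1 le3 by auto
      then have "m = R2 g \<alpha> w lam x" by (simp add: m_def min.absorb1 max.absorb1)
      with 2 \<open>\<not> lam + r1 < - x\<close> show ?thesis by (auto simp: U abs_if)
    next
      case 3
      then have "m = ereal r3" using le3 r13 by (simp add: m_def min.absorb2 max.absorb1)
      with 3 True \<open>\<not> lam + r1 < - x\<close> show ?thesis by (auto simp: U abs_if)
    qed
    with True show ?thesis by (simp add: H1)
  next
    case False
    \<comment> \<open>Since \<open>lam \<le> x + R2\<close>, this case forces \<open>R3 < R2\<close>, which rules out regime II and the
      right-hand part of regime I.\<close>
    have "ereal r3 \<le> R2 g \<alpha> w lam x"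
      using False by (intro order_trans[OF _ ge_lam]) auto
    then have "x \<le> - lam + r3" "x \<le> lam + r1"
      using le1 le3 r13 by (auto intro: order_trans[of "ereal r1" "ereal r3"])
    with False show ?thesis by (auto simp: U H2 abs_if min_def)
  qed
  with ge show "U_end g \<alpha> w lam x =
      H1 g \<alpha> w lam x * of_bool (ereal lam \<le> H1 g \<alpha> w lam x) +
      H2 g \<alpha> w lam x * of_bool (H1 g \<alpha> w lam x < ereal lam)"
    by (simp add: not_le[symmetric])
qed

end
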